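(* Let $\mathcal{A}\in\mathbb{C}^{I_1\times\cdots\times I_N\times J_1\times\cdots\times J_N}$ and $\mathcal{B}\in\mathbb{C}^{J_1\times\cdots\times J_N\times I_1\times\cdots\times I_N}$. Then $(\mathcal{A}*_N\mathcal{B})^{\dagger}=\mathcal{B}^{\dagger}*_N\mathcal{A}^{\dagger}$ if and only if both $$\mathcal{A}^{\dagger}*_N\mathcal{A}*_N\mathcal{B}*_N\mathcal{B}^**_N\mathcal{A}^*=\mathcal{B}*_N\mathcal{B}^**_N\mathcal{A}^*$$ and $$\mathcal{B}*_N\mathcal{B}^{\dagger}*_N\mathcal{A}^**_N\mathcal{A}*_N\mathcal{B}=\mathcal{A}^**_N\mathcal{A}*_N\mathcal{B}$$ hold.
   Context: Tensors are complex multiway arrays, with entries of $\mathcal{A}\in\mathbb{C}^{I_1\times\cdots\times I_N\times J_1\times\cdots\times J_N}$ denoted $a_{i_1\ldots i_N j_1\ldots j_N}$. The Einstein product of $\mathcal{A}\in\mathbb{C}^{I_1\times\cdots\times I_N\times K_1\times\cdots\times K_N}$ and $\mathcal{B}\in\mathbb{C}^{K_1\times\cdots\times K_N\times J_1\times\cdots\times J_M}$ is the tensor $\mathcal{A}*_N\mathcal{B}\in\mathbb{C}^{I_1\times\cdots\times I_N\times J_1\times\cdots\times J_M}$ with $(\mathcal{A}*_N\mathcal{B})_{i_1\ldots i_N j_1\ldots j_M}=\sum_{k_1\ldots k_N}a_{i_1\ldots i_N k_1\ldots k_N}b_{k_1\ldots k_N j_1\ldots j_M}$; it is associative. The conjugate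 transpose $\mathcal{A}^*\in\mathbb{C}^{J_1\times\cdots\times J_N\times I_1\times\cdots\times I_N}$ has entries $(\mathcal{A}^* )_{j_1\ldots j_N i_1\ldots i_N}=\overline{a_{i_1\ldots i_N j_1\ldots j_N}}$. The Moore-Penrose inverse $\mathcal{A}^{\dagger}$ of $\mathcal{A}\in\mathbb{C}^{I_1\times\cdots\times I_N\times J_1\times\cdots\times J_N}$ is the unique tensor $\mathcal{X}\in\mathbb{C}^{J_1\times\cdots\times J_N\times I_1\times\cdots\times I_N}$ (it always exists) satisfying (1) $\mathcal{A}*_N\mathcal{X}*_N\mathcal{A}=\mathcal{A}$; (2) $\mathcal{X}*_N\mathcal{A}*_N\mathcal{X}=\mathcal{X}$; (3) $(\mathcal{A}*_N\mathcal{X})^*=\mathcal{A}*_N\mathcal{X}$; (4) $(\mathcal{X}*_N\mathcal{A})^*=\mathcal{X}*_N\mathcal{A}$. *)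

theory Defs
  imports Complex_Main
begin

text \<open>
  A tensor consists of the list of its dimensions and its entries, which are indexed by the
  multi-indices \<open>[i\<^sub>1, \<dots>, i\<^sub>n]\<close> with \<open>1 \<le> i\<^sub>k \<le> d\<^sub>k\<close>.  Entries outside this range are fixed to be
  \<open>0\<close>, so that equality of tensors is equality of the dimensions and of all entries.
  The space of tensors of size \<open>I\<^sub>1 \<times> \<dots> \<times> I\<^sub>N \<times> J\<^sub>1 \<times> \<dots> \<times> J\<^sub>N\<close> consists of the tensors whose
  dimension list is \<open>I @ J\<close> with \<open>length I = length J = N\<close>, and their multi-indices have the
  form \<open>i @ j\<close>.
\<close>

definition multi_indices :: "nat list \<Rightarrow> nat list set" where
  "multi_indices ds = listset (map (\<lambda>d. {1..d}) ds)"

typedef tensor =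
  "{(ds, a). \<forall>l. l \<notin> multi_indices ds \<longrightarrow> a l = 0} :: (nat list \<times> (nat list \<Rightarrow> complex)) set"
  by (rule exI [of _ "([], \<lambda>_. 0)"]) simp

setup_lifting type_definition_tensor

lift_definition dims :: "tensor \<Rightarrow> nat list" is fst .

lift_definition entry :: "tensor \<Rightarrow> nat list \<Rightarrow> complex" is snd .

lift_definition mk_tensor :: "nat list \<Rightarrow> (nat list \<Rightarrow> complex) \<Rightarrow> tensor" is
  "\<lambda>ds f. (ds, \<lambda>l. if l \<in> multi_indices ds then f l else 0)"
  by simp

lemma dims_mk_tensor [simp]: "dims (mk_tensor ds f) = ds"
  by transfer simp

lemma entry_mk_tensor:
  "entry (mk_tensor ds f) l = (if l \<in> multi_indices ds then f l else 0)"
  by transfer simp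

lemma entry_outside: "l \<notin> multi_indices (dims A) \<Longrightarrow> entry A l = 0"
  by transfer auto

lemma tensor_eqI:
  assumes "dims A = dims B"
    and "\<And>l. l \<in> multi_indices (dims A) \<Longrightarrow> entry A l = entry B l"
  shows "A = B"
proof -
  have "entry A = entry B"
    using assms entry_outside by (metis ext)
  with assms(1) show ?thesis
    by transfer (simp add: prod_eq_iff)
qed

text \<open>
  In the next three definitions the parameter \<open>N\<close> is the number of leading indices, i.e. half
  the order of \<open>A\<close>.  The Einstein product is meaningful if \<open>dims A = I @ K\<close> and
  \<open>dims B = K @ J\<close> with \<open>length I = length K = N\<close>; the length of \<open>J\<close> is arbitrary.
\<close>

definition einstein_prod :: "tensor \<Rightarrow> nat \<Rightarrow> tensor \<Rightarrow> tensor"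
    ("(_ \<star>\<^bsub>_\<^esub>/ _)" [70, 0, 71] 70) where
  "A \<star>\<^bsub>N\<^esub> B =
    mk_tensor (take N (dims A) @ drop N (dims B))
      (\<lambda>l. \<Sum>k \<in> multi_indices (take N (dims B)).
              entry A (take N l @ k) * entry B (k @ drop N l))"

definition conj_transpose :: "nat \<Rightarrow> tensor \<Rightarrow> tensor" where
  "conj_transpose N A =
    mk_tensor (drop N (dims A) @ take N (dims A))
      (\<lambda>l. cnj (entry A (drop N l @ take N l)))"

definition is_mp_inverse :: "nat \<Rightarrow> tensor \<Rightarrow> tensor \<Rightarrow> bool" where
  "is_mp_inverse N A X \<longleftrightarrow>
    dims X = drop N (dims A) @ take N (dims A) \<and>
    A \<star>\<^bsub>N\<^esub> X \<star>\<^bsub>N\<^esub> A = A \<and>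
    X \<star>\<^bsub>N\<^esub> A \<star>\<^bsub>N\<^esub> X = X \<and>
    conj_transpose N (A \<star>\<^bsub>N\<^esub> X) = A \<star>\<^bsub>N\<^esub> X \<and>
    conj_transpose N (X \<star>\<^bsub>N\<^esub> A) = X \<star>\<^bsub>N\<^esub> A"

definition mp_inverse :: "nat \<Rightarrow> tensor \<Rightarrow> tensor" where
  "mp_inverse N A = (THE X. is_mp_inverse N A X)"

end

theory Submission
  imports Defs "HOL-Library.Function_Algebras"
begin

text \<open>
  Extended by zero, the tensors of order \<open>2N\<close> of all sizes form one semigroup with involution under
  the Einstein product, and the claim relates equations in that semigroup.  Three properties
  suffice: the product is associative and reversed by the conjugate transpose; the involution is
  proper (a sum of squared moduli vanishes only if every term does, \<open>conj_transpose_proper\<close>); and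
  every element has an inner inverse (\<open>tensor_inner_inverse\<close>, which holds because every linear map
  \<open>f\<close> has a linear \<open>h\<close> with \<open>f \<circ> h \<circ> f = f\<close>).  They yield existence and uniqueness of
  Moore-Penrose inverses (\<open>penrose_exists\<close>, \<open>penrose_unique\<close>).

  The equivalence (\<open>reverse_order_law\<close>) is Greville's argument.  Write \<open>x\<close>, \<open>y\<close> for the
  Moore-Penrose inverses of \<open>a\<close>, \<open>b\<close>, and \<open>p = xa\<close>, \<open>q = by\<close> for the orthogonal projections onto
  the ranges of \<open>a\<^sup>*\<close> and \<open>b\<close>.  The two conditions say that \<open>p\<close> fixes \<open>bb\<^sup>*a\<^sup>*\<close> and that \<open>q\<close> fixes
  \<open>a\<^sup>*ab\<close>.  They are exchanged by replacing \<open>(a, b)\<close> with \<open>(b\<^sup>*, a\<^sup>*)\<close>, so the lemmas treat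
  only the first one.

  If \<open>yx\<close> is the Moore-Penrose inverse of \<open>ab\<close>, then \<open>yx(ab)(ab)\<^sup>* = (ab)\<^sup>*\<close>, hence \<open>qph = h\<close> for
  \<open>h = bb\<^sup>*a\<^sup>* = qh\<close>.  Projections do not increase norms, and \<open>ph\<close> has the same norm as \<open>h\<close> only if
  \<open>ph = h\<close> (\<open>fixed_by_projection_if\<close>).  Conversely, if \<open>p\<close> fixes \<open>bb\<^sup>*a\<^sup>*\<close>, then \<open>p\<close> commutes with
  \<open>bb\<^sup>*\<close> and therefore with \<open>q\<close> (\<open>projections_commute\<close>), and this gives the first two Penrose
  equations for \<open>yx\<close>; the two conditions give one Hermitian equation each
  (\<open>hermitian_if_absorption\<close>).
\<close>

section \<open>Moore-Penrose inverses in proper regular semigroups with involution\<close>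

text \<open>
  The elements stand for matrices of various sizes whose product is total.  Properness is the
  subtraction-free form of \<open>(x - y)\<^sup>*(x - y) = 0 \<Longrightarrow> x = y\<close>.  The map \<open>row\<close> records the row
  index set: \<open>x\<close> and \<open>y\<close> may satisfy both equations of \<open>proper\<close> and still differ by additional
  zero rows, so properness can only be required when \<open>row x = row y\<close>.
\<close>

locale regular_star_semigroup =
  fixes S :: "'a set"
    and mult :: "'a \<Rightarrow> 'a \<Rightarrow> 'a" (infixl "\<cdot>" 70)
    and star :: "'a \<Rightarrow> 'a"
    and row :: "'a \<Rightarrow> 'r"
  assumes mult_closed [simp]: "x \<in> S \<Longrightarrow> y \<in> S \<Longrightarrow> x \<cdot> y \<in> S"
    and star_closed [simp]: "x \<in> S \<Longrightarrow> star x \<in> S"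
    and assoc: "x \<in> S \<Longrightarrow> y \<in> S \<Longrightarrow> z \<in> S \<Longrightarrow> x \<cdot> y \<cdot> z = x \<cdot> (y \<cdot> z)"
    and star_mult: "x \<in> S \<Longrightarrow> y \<in> S \<Longrightarrow> star (x \<cdot> y) = star y \<cdot> star x"
    and star_star [simp]: "x \<in> S \<Longrightarrow> star (star x) = x"
    and row_mult: "x \<in> S \<Longrightarrow> y \<in> S \<Longrightarrow> row (x \<cdot> y) = row x"
    and proper: "x \<in> S \<Longrightarrow> y \<in> S \<Longrightarrow> row x = row y \<Longrightarrow>
      star x \<cdot> x = star x \<cdot> y \<Longrightarrow> star y \<cdot> y = star y \<cdot> x \<Longrightarrow> x = y"
    and regular: "a \<in> S \<Longrightarrow> \<exists>g\<in>S. a \<cdot> g \<cdot> a = a"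
begin

definition penrose :: "'a \<Rightarrow> 'a \<Rightarrow> bool" where
  "penrose a x \<longleftrightarrow> a \<cdot> x \<cdot> a = a \<and> x \<cdot> a \<cdot> x = x \<and>
     star (a \<cdot> x) = a \<cdot> x \<and> star (x \<cdot> a) = x \<cdot> a"

lemma star_cancel_left:
  assumes "a \<in> S" "x \<in> S" "y \<in> S" and eq: "star a \<cdot> (a \<cdot> x) = star a \<cdot> (a \<cdot> y)"
  shows "a \<cdot> x = a \<cdot> y"
  by (rule proper) (use assms in \<open>simp_all add: row_mult star_mult assoc\<close>)

lemma star_cancel_right:
  assumes "a \<in> S" "x \<in> S" "y \<in> S" and eq: "x \<cdot> a \<cdot> star a = y \<cdot> a \<cdot> star a"
  shows "x \<cdot> a = y \<cdot> a"
proof -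
  have "star a \<cdot> star x = star a \<cdot> star y"
  proof (rule star_cancel_left)
    show "star (star a) \<cdot> (star a \<cdot> star x) = star (star a) \<cdot> (star a \<cdot> star y)"
      using arg_cong [OF eq, of star] assms(1-3) by (simp add: star_mult assoc)
  qed (use assms in simp_all)
  then have "star (star a \<cdot> star x) = star (star a \<cdot> star y)" by simp
  then show ?thesis using assms by (simp add: star_mult)
qed

lemma penrose_star:
  assumes "a \<in> S" "x \<in> S" "penrose a x"
  shows "penrose (star a) (star x)"
proof -
  have "star a \<cdot> star x = x \<cdot> a" "star x \<cdot> star a = a \<cdot> x"
    using assms by (simp_all add: penrose_def flip: star_mult)
  moreover have "x \<cdot> a \<cdot> star a = star a" "a \<cdot> x \<cdot> star x = star x"
  proof -
    have "x \<cdot> a \<cdot> star a = star (a \<cdot> (x \<cdot> a))" "a \<cdot> x \<cdot> star x = star (x \<cdot> (a \<cdot> x))"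
      using assms by (simp_all add: penrose_def star_mult [of a "x \<cdot> a"] star_mult [of x "a \<cdot> x"])
    then show "x \<cdot> a \<cdot> star a = star a" "a \<cdot> x \<cdot> star x = star x"
      using assms by (simp_all add: penrose_def assoc)
  qed
  ultimately show ?thesis
    using assms by (simp add: penrose_def)
qed

text \<open>
  The Moore-Penrose inverse has the size of the conjugate transpose: \<open>x = xax = a\<^sup>*x\<^sup>*x\<close>.
\<close>

lemma penrose_row:
  assumes "a \<in> S" "x \<in> S" "penrose a x"
  shows "row x = row (star a)"
proof -
  have "x = star (x \<cdot> a) \<cdot> x"
    using assms by (simp add: penrose_def)
  also have "\<dots> = star a \<cdot> (star x \<cdot> x)"
    using assms(1,2) by (simp add: star_mult assoc)
  finally show ?thesis
    using row_mult [of "star a" "star x \<cdot> x"] assms(1,2) by simp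
qed

text \<open>
  The projection \<open>ax\<close> onto the range of \<open>a\<close> does not depend on \<open>x\<close>, and likewise \<open>xa\<close>;
  then \<open>x = xax = yax = yay = y\<close>.
\<close>

lemma penrose_unique:
  assumes "a \<in> S" "x \<in> S" "y \<in> S" "penrose a x" "penrose a y"
  shows "x = y"
proof -
  have right: "a \<cdot> u = a \<cdot> v"
    if "a \<in> S" "u \<in> S" "v \<in> S" "penrose a u" "penrose a v" for a u v
  proof -
    have "a \<cdot> u = (a \<cdot> v) \<cdot> (a \<cdot> u)"
      using that by (simp add: penrose_def flip: assoc)
    also have "\<dots> = star ((a \<cdot> u) \<cdot> (a \<cdot> v))"
      using that by (simp add: penrose_def star_mult [of "a \<cdot> u" "a \<cdot> v"])
    also have "(a \<cdot> u) \<cdot> (a \<cdot> v) = a \<cdot> v"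
      using that by (simp add: penrose_def flip: assoc)
    also have "star (a \<cdot> v) = a \<cdot> v"
      using that by (simp add: penrose_def)
    finally show ?thesis .
  qed
  have "a \<cdot> x = a \<cdot> y" by (rule right) (use assms in simp_all)
  moreover have "x \<cdot> a = y \<cdot> a"
  proof -
    have "star a \<cdot> star x = star a \<cdot> star y"
      by (rule right) (use assms penrose_star in simp_all)
    then have "star (star a \<cdot> star x) = star (star a \<cdot> star y)" by simp
    then show ?thesis using assms by (simp add: star_mult)
  qed
  moreover have "x = x \<cdot> (a \<cdot> x)" "y \<cdot> (a \<cdot> y) = y"
    using assms by (simp_all add: penrose_def flip: assoc)
  ultimately show ?thesis
    using assms(1-3) by (metis assoc)
qed

text \<open>
  If \<open>g\<close> is an inner inverse of the Gram element \<open>a\<^sup>*a\<close>, then \<open>ga\<^sup>*\<close> solves the normal equations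
  for \<open>a\<close>: cancelling \<open>a\<^sup>*\<close> on the left of \<open>a\<^sup>*a g a\<^sup>*a = a\<^sup>*a\<close> leaves \<open>a g a\<^sup>* a = a\<close>.
  Inserting the adjoint of this equation, \<open>a g a\<^sup>* = (a g a\<^sup>* a) g\<^sup>* a\<^sup>* = a g\<^sup>* a\<^sup>*\<close>, which makes
  \<open>a g a\<^sup>*\<close> Hermitian.
\<close>

lemma least_squares_inverse_exists:
  assumes "a \<in> S"
  shows "\<exists>x\<in>S. a \<cdot> x \<cdot> a = a \<and> star (a \<cdot> x) = a \<cdot> x"
proof -
  obtain g where g: "g \<in> S" and inner: "star a \<cdot> a \<cdot> g \<cdot> (star a \<cdot> a) = star a \<cdot> a"
    using regular [of "star a \<cdot> a"] assms by auto
  have right: "star a \<cdot> a \<cdot> (g \<cdot> star a) \<cdot> a = star a \<cdot> a"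
    using inner assms g by (simp add: assoc)
  have fix_a: "a \<cdot> (g \<cdot> star a) \<cdot> a = a"
  proof (rule proper)
    show "star (a \<cdot> (g \<cdot> star a) \<cdot> a) \<cdot> (a \<cdot> (g \<cdot> star a) \<cdot> a) = star (a \<cdot> (g \<cdot> star a) \<cdot> a) \<cdot> a"
      using right assms g by (simp add: star_mult assoc)
    show "star a \<cdot> a = star a \<cdot> (a \<cdot> (g \<cdot> star a) \<cdot> a)"
      using right assms g by (simp add: assoc)
  qed (use assms g in \<open>simp_all add: row_mult\<close>)
  have "star a = star a \<cdot> a \<cdot> star g \<cdot> star a"
    using arg_cong [OF fix_a, of star] assms g by (simp add: star_mult assoc)
  then have "a \<cdot> g \<cdot> star a = a \<cdot> g \<cdot> (star a \<cdot> a \<cdot> star g \<cdot> star a)" by simp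
  also have "\<dots> = (a \<cdot> (g \<cdot> star a) \<cdot> a) \<cdot> (star g \<cdot> star a)"
    using assms g by (simp add: assoc)
  also have "\<dots> = star (a \<cdot> (g \<cdot> star a))"
    using assms g by (simp only: fix_a) (simp add: star_mult assoc)
  finally have "star (a \<cdot> (g \<cdot> star a)) = a \<cdot> (g \<cdot> star a)"
    using assms g by (simp add: assoc)
  with fix_a show ?thesis
    using assms g by (intro bexI [of _ "g \<cdot> star a"]) simp_all
qed

text \<open>
  Urquhart's formula: if \<open>u\<close> and \<open>v\<close> are inner inverses of \<open>a\<close> for which \<open>au\<close> and \<open>va\<close> are
  Hermitian, then \<open>vau\<close> is the Moore-Penrose inverse.  The element \<open>v\<close> comes from the least squares
  inverse of \<open>a\<^sup>*\<close>.
\<close>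

lemma penrose_exists:
  assumes "a \<in> S"
  shows "\<exists>x\<in>S. penrose a x"
proof -
  obtain u where u: "u \<in> S" "a \<cdot> u \<cdot> a = a" "star (a \<cdot> u) = a \<cdot> u"
    using least_squares_inverse_exists [OF assms] by blast
  obtain w where w: "w \<in> S" "star a \<cdot> w \<cdot> star a = star a" "star (star a \<cdot> w) = star a \<cdot> w"
    using least_squares_inverse_exists [of "star a"] assms by auto
  define v where "v = star w"
  have v: "v \<in> S" "a \<cdot> v \<cdot> a = a" "star (v \<cdot> a) = v \<cdot> a"
    using w(1,3) arg_cong [OF w(2), of star] assms by (simp_all add: v_def star_mult assoc)
  have ax: "a \<cdot> (v \<cdot> a \<cdot> u) = a \<cdot> u"
    using assms u(1) v(1,2) by (simp flip: assoc)
  have xa: "(v \<cdot> a \<cdot> u) \<cdot> a = v \<cdot> a"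
    using assms u(1,2) v(1) by (simp add: assoc)
  have "penrose a (v \<cdot> a \<cdot> u)"
    unfolding penrose_def ax xa
  proof (intro conjI)
    show "v \<cdot> a \<cdot> (v \<cdot> a \<cdot> u) = v \<cdot> a \<cdot> u"
      using ax assms u(1) v(1) by (simp add: assoc)
  qed (use u v in simp_all)
  moreover have "v \<cdot> a \<cdot> u \<in> S" using assms u(1) v(1) by simp
  ultimately show ?thesis by blast
qed

text \<open>
  The compression \<open>qpq\<close> is Hermitian, hence so is \<open>pq\<close>.
\<close>

lemma commute_if_compression_eq:
  assumes "p \<in> S" "q \<in> S" "star p = p" "star q = q" "q \<cdot> p \<cdot> q = p \<cdot> q"
  shows "p \<cdot> q = q \<cdot> p"
proof -
  have "q \<cdot> p = star (p \<cdot> q)" using assms by (simp add: star_mult)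
  also have "\<dots> = star (q \<cdot> p \<cdot> q)" using assms by simp
  also have "\<dots> = q \<cdot> p \<cdot> q" using assms(1-4) by (simp add: star_mult assoc)
  finally show ?thesis using assms by simp
qed

text \<open>
  The equality case of \<open>\<parallel>h\<parallel> = \<parallel>qph\<parallel> \<le> \<parallel>ph\<parallel> \<le> \<parallel>h\<parallel>\<close>.  In terms of the involution:
  \<open>h\<^sup>*h = h\<^sup>*qph = (qh)\<^sup>*ph = h\<^sup>*ph = (ph)\<^sup>*(ph)\<close>, so \<open>h - ph\<close> vanishes by properness.
\<close>

lemma fixed_by_projection_if:
  assumes S: "p \<in> S" "q \<in> S" "h \<in> S"
    and p: "star p = p" "p \<cdot> p = p" and q: "star q = q"
    and row: "row p = row h"
    and qh: "q \<cdot> h = h" and qph: "q \<cdot> (p \<cdot> h) = h"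
  shows "p \<cdot> h = h"
proof (rule proper)
  have pp: "p \<cdot> (p \<cdot> h) = p \<cdot> h" using S p by (simp flip: assoc)
  then show "star (p \<cdot> h) \<cdot> (p \<cdot> h) = star (p \<cdot> h) \<cdot> h"
    using S p by (simp add: star_mult assoc)
  have "star h \<cdot> h = star h \<cdot> (q \<cdot> (p \<cdot> h))" using qph by simp
  also have "\<dots> = star (q \<cdot> h) \<cdot> (p \<cdot> h)" using S q by (simp add: star_mult assoc)
  finally show "star h \<cdot> h = star h \<cdot> (p \<cdot> h)" using qh by simp
qed (use S row in \<open>simp_all add: row_mult\<close>)

text \<open>
  Multiplying \<open>yx(ab)(ab)\<^sup>* = (ab)\<^sup>*\<close> by \<open>b\<close> on the left gives \<open>qph = h\<close> with \<open>p = xa\<close>, \<open>q = by\<close>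
  and \<open>h = bb\<^sup>*a\<^sup>*\<close>, and \<open>q\<close> can be dropped because \<open>qh = h\<close>.
\<close>

lemma absorption_if_reproduces_star:
  assumes S: "a \<in> S" "b \<in> S" "x \<in> S" "y \<in> S" and mp: "penrose a x" "penrose b y"
    and row: "row b = row (star a)"
    and c: "y \<cdot> x \<cdot> (a \<cdot> b) \<cdot> star (a \<cdot> b) = star (a \<cdot> b)"
  shows "x \<cdot> a \<cdot> b \<cdot> star b \<cdot> star a = b \<cdot> star b \<cdot> star a"
proof -
  have bbb: "(b \<cdot> y) \<cdot> b = b" using mp by (simp add: penrose_def)
  have "(x \<cdot> a) \<cdot> (b \<cdot> star b \<cdot> star a) = b \<cdot> star b \<cdot> star a"
  proof (rule fixed_by_projection_if [where q = "b \<cdot> y"])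
    show "(x \<cdot> a) \<cdot> (x \<cdot> a) = x \<cdot> a" 
      using S mp by (simp add: penrose_def flip: assoc)
    show "b \<cdot> y \<cdot> (b \<cdot> star b \<cdot> star a) = b \<cdot> star b \<cdot> star a"
      using bbb S by (simp flip: assoc)
    show "b \<cdot> y \<cdot> (x \<cdot> a \<cdot> (b \<cdot> star b \<cdot> star a)) = b \<cdot> star b \<cdot> star a"
      using arg_cong [OF c, of "\<lambda>z. b \<cdot> z"] S by (simp add: assoc star_mult)
    show "row (x \<cdot> a) = row (b \<cdot> star b \<cdot> star a)"
      using S mp row by (simp add: row_mult penrose_row)
  qed (use S mp in \<open>simp_all add: penrose_def\<close>)
  then show ?thesis using S by (simp add: assoc)
qed

text \<open>
  Multiplying the hypothesis by \<open>x\<^sup>*\<close> on the right shows that the range of \<open>bb\<^sup>*p\<close> lies in that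
  of \<open>p\<close>; as both factors are Hermitian, \<open>p\<close> commutes with \<open>bb\<^sup>*\<close>, and so it maps the range of
  \<open>b\<close>, which is that of \<open>bb\<^sup>*\<close>, to itself, that is \<open>qpq = pq\<close>.
\<close>

lemma projections_commute:
  assumes S: "a \<in> S" "b \<in> S" "x \<in> S" "y \<in> S" and mp: "penrose a x" "penrose b y"
    and inv: "x \<cdot> a \<cdot> b \<cdot> star b \<cdot> star a = b \<cdot> star b \<cdot> star a"
  shows "(x \<cdot> a) \<cdot> (b \<cdot> y) = (b \<cdot> y) \<cdot> (x \<cdot> a)"
proof -
  define p q k where "p = x \<cdot> a" and "q = b \<cdot> y" and "k = b \<cdot> star b"
  have pqk: "p \<in> S" "q \<in> S" "k \<in> S" "star p = p" "star q = q" "star k = k"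
    using S mp by (simp_all add: p_def q_def k_def penrose_def star_mult)
  have p: "star a \<cdot> star x = p"
    using S mp by (simp add: p_def penrose_def flip: star_mult)
  have "(p \<cdot> k \<cdot> star a) \<cdot> star x = (k \<cdot> star a) \<cdot> star x"
    using inv S by (simp add: p_def k_def assoc)
  then have "p \<cdot> k \<cdot> p = k \<cdot> p" using S pqk p by (simp add: assoc)
  then have pk: "k \<cdot> p = p \<cdot> k" using commute_if_compression_eq [of k p] pqk by simp
  have qb: "q \<cdot> b = b" using mp by (simp add: q_def penrose_def)
  then have qk: "q \<cdot> k = k" using S pqk by (simp add: k_def flip: assoc)
  have "q \<cdot> p \<cdot> b \<cdot> star b = q \<cdot> (k \<cdot> p)" using S pqk pk by (simp add: k_def assoc)
  also have "\<dots> = p \<cdot> k" using pqk qk by (simp add: pk [symmetric] flip: assoc)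
  finally have "q \<cdot> p \<cdot> b \<cdot> star b = p \<cdot> b \<cdot> star b"
    using S pqk by (simp add: k_def assoc)
  then have "q \<cdot> p \<cdot> b = p \<cdot> b"
    using star_cancel_right [of b "q \<cdot> p" p] S pqk by simp
  then have "q \<cdot> p \<cdot> b \<cdot> y = p \<cdot> b \<cdot> y" by simp
  then have "q \<cdot> p \<cdot> q = p \<cdot> q" using S pqk by (simp add: q_def assoc)
  then have "p \<cdot> q = q \<cdot> p" using pqk by (intro commute_if_compression_eq)
  then show ?thesis by (simp add: p_def q_def)
qed

text \<open>
  The hypothesis turns \<open>(zc)\<^sup>* = c\<^sup>*z\<^sup>*\<close> into \<open>(zc)(zc)\<^sup>*\<close>, which is Hermitian.
\<close>

lemma hermitian_if_reproduces_star:
  assumes "c \<in> S" "z \<in> S" and eq: "z \<cdot> c \<cdot> star c = star c"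
  shows "star (z \<cdot> c) = z \<cdot> c"
proof -
  have "star (z \<cdot> c) = star c \<cdot> star z" using assms by (simp add: star_mult)
  also have "\<dots> = z \<cdot> c \<cdot> star c \<cdot> star z" using eq by simp
  also have "\<dots> = (z \<cdot> c) \<cdot> star (z \<cdot> c)" using assms(1,2) by (simp add: star_mult assoc)
  finally have *: "star (z \<cdot> c) = (z \<cdot> c) \<cdot> star (z \<cdot> c)" .
  have "z \<cdot> c = star (star (z \<cdot> c))" using assms by simp
  also have "\<dots> = star ((z \<cdot> c) \<cdot> star (z \<cdot> c))" using * by simp
  also have "\<dots> = (z \<cdot> c) \<cdot> star (z \<cdot> c)" using assms(1,2) by (simp add: star_mult)
  finally show ?thesis using * by simp
qed

text \<open>
  Multiplying the hypothesis by \<open>y\<close> on the left gives \<open>yx(ab)(ab)\<^sup>* = (ab)\<^sup>*\<close>, because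
  \<open>ybb\<^sup>* = b\<^sup>*\<close>.
\<close>

lemma hermitian_if_absorption:
  assumes S: "a \<in> S" "b \<in> S" "x \<in> S" "y \<in> S" and mp: "penrose a x" "penrose b y"
    and inv: "x \<cdot> a \<cdot> b \<cdot> star b \<cdot> star a = b \<cdot> star b \<cdot> star a"
  shows "star (y \<cdot> x \<cdot> (a \<cdot> b)) = y \<cdot> x \<cdot> (a \<cdot> b)"
proof (rule hermitian_if_reproduces_star)
  have "y \<cdot> b \<cdot> star b = star (b \<cdot> (y \<cdot> b))"
    using S mp by (simp add: star_mult [of b "y \<cdot> b"] penrose_def)
  then have yb: "y \<cdot> b \<cdot> star b = star b" using S mp by (simp add: penrose_def assoc)
  have "y \<cdot> x \<cdot> (a \<cdot> b) \<cdot> star (a \<cdot> b) = y \<cdot> (x \<cdot> a \<cdot> b \<cdot> star b \<cdot> star a)"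
    using S by (simp add: star_mult assoc)
  also have "\<dots> = y \<cdot> b \<cdot> star b \<cdot> star a" using S by (simp add: inv) (simp add: assoc)
  finally show "y \<cdot> x \<cdot> (a \<cdot> b) \<cdot> star (a \<cdot> b) = star (a \<cdot> b)"
    using S yb by (simp add: star_mult)
qed (use S in simp_all)

lemma penrose_reproduces_star:
  assumes "c \<in> S" "z \<in> S" "penrose c z"
  shows "z \<cdot> c \<cdot> star c = star c"
proof -
  have "z \<cdot> c \<cdot> star c = star (c \<cdot> (z \<cdot> c))"
    using assms by (simp add: star_mult [of c "z \<cdot> c"] penrose_def)
  then show ?thesis using assms by (simp add: penrose_def assoc)
qed

text \<open>
  Both directions use the preceding lemmas twice, for \<open>(a, b)\<close> and for \<open>(b\<^sup>*, a\<^sup>*)\<close>; the second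
  condition is the first one for the latter pair, since \<open>y\<^sup>*b\<^sup>* = by\<close>.
\<close>

lemma reverse_order_law:
  assumes S: "a \<in> S" "b \<in> S" "x \<in> S" "y \<in> S" and mp: "penrose a x" "penrose b y"
    and row: "row b = row (star a)" "row a = row (star b)"
  shows "penrose (a \<cdot> b) (y \<cdot> x) \<longleftrightarrow>
    x \<cdot> a \<cdot> b \<cdot> star b \<cdot> star a = b \<cdot> star b \<cdot> star a \<and>
    b \<cdot> y \<cdot> star a \<cdot> a \<cdot> b = star a \<cdot> a \<cdot> b" (is "?L \<longleftrightarrow> ?R1 \<and> ?R2")
proof -
  have S': "star a \<in> S" "star b \<in> S" "star x \<in> S" "star y \<in> S" using S by simp_all
  have mp': "penrose (star a) (star x)" "penrose (star b) (star y)"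
    using S mp by (simp_all add: penrose_star)
  have star_yb: "star y \<cdot> star b = b \<cdot> y" 
    using S mp by (simp add: penrose_def flip: star_mult)
  show ?thesis
  proof (intro iffI conjI)
    assume L: ?L
    show ?R1
      using penrose_reproduces_star [OF _ _ L] S by (intro absorption_if_reproduces_star [OF S mp row(1)]) simp
    have "penrose (star b \<cdot> star a) (star x \<cdot> star y)"
      using penrose_star [OF _ _ L] S by (simp add: star_mult)
    then have "star y \<cdot> star b \<cdot> star a \<cdot> star (star a) \<cdot> star (star b) = star a \<cdot> star (star a) \<cdot> star (star b)"
      using S S' mp' row by (intro absorption_if_reproduces_star penrose_reproduces_star) simp_all
    then show ?R2 using S by (simp add: star_yb)
  next
    assume R: "?R1 \<and> ?R2"
    then have R1: ?R1 and R2: ?R2 by simp_all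
    have comm: "(x \<cdot> a) \<cdot> (b \<cdot> y) = (b \<cdot> y) \<cdot> (x \<cdot> a)"
      by (rule projections_commute [OF S mp R1])
    have "star y \<cdot> star b \<cdot> star a \<cdot> star (star a) \<cdot> star (star b) = star a \<cdot> star (star a) \<cdot> star (star b)"
      using R2 S by (simp add: star_yb)
    then have "star (star x \<cdot> star y \<cdot> (star b \<cdot> star a)) = star x \<cdot> star y \<cdot> (star b \<cdot> star a)"
      using S' mp' by (intro hermitian_if_absorption) simp_all
    then have h2: "star (a \<cdot> b \<cdot> (y \<cdot> x)) = a \<cdot> b \<cdot> (y \<cdot> x)"
      using S by (simp add: star_mult assoc)
    have "a \<cdot> b \<cdot> (y \<cdot> x) \<cdot> (a \<cdot> b) = a \<cdot> ((b \<cdot> y) \<cdot> (x \<cdot> a)) \<cdot> b"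
      using S by (simp add: assoc)
    also have "\<dots> = (a \<cdot> x \<cdot> a) \<cdot> (b \<cdot> y \<cdot> b)"
      using S by (simp add: assoc flip: comm)
    finally have e1: "a \<cdot> b \<cdot> (y \<cdot> x) \<cdot> (a \<cdot> b) = a \<cdot> b" using mp by (simp add: penrose_def)
    have "y \<cdot> x \<cdot> (a \<cdot> b) \<cdot> (y \<cdot> x) = y \<cdot> ((x \<cdot> a) \<cdot> (b \<cdot> y)) \<cdot> x"
      using S by (simp add: assoc)
    also have "\<dots> = (y \<cdot> b \<cdot> y) \<cdot> (x \<cdot> a \<cdot> x)"
      using S by (simp only: comm) (simp add: assoc)
    finally have e2: "y \<cdot> x \<cdot> (a \<cdot> b) \<cdot> (y \<cdot> x) = y \<cdot> x" using mp by (simp add: penrose_def)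
    show ?L
      unfolding penrose_def using e1 e2 h2 hermitian_if_absorption [OF S mp R1] by simp
  qed
qed

end


section \<open>Tensors of even order as matrices over multi-indices\<close>

lemma mem_multi_indices_append:
  "l \<in> multi_indices (ds @ es) \<longleftrightarrow> (\<exists>i\<in>multi_indices ds. \<exists>j\<in>multi_indices es. l = i @ j)"
proof (induction ds arbitrary: l)
  case Nil
  show ?case by (simp add: multi_indices_def)
next
  case (Cons d ds)
  have "multi_indices (d # fs) = {x # k |x k. x \<in> {1..d} \<and> k \<in> multi_indices fs}" for fs
    by (simp add: multi_indices_def set_Cons_def)
  then show ?case using Cons.IH by fastforce
qed

lemma finite_multi_indices [simp]: "finite (multi_indices ds)"
proof (induction ds)
  case (Cons d ds)
  have "multi_indices (d # ds) = case_prod (#) ` ({1..d} \<times> multi_indices ds)"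
    by (auto simp: multi_indices_def set_Cons_def)
  with Cons show ?case by simp
qed (simp add: multi_indices_def)

lemma length_multi_indices: "l \<in> multi_indices ds \<Longrightarrow> length l = length ds"
  by (induction ds arbitrary: l) (auto simp: multi_indices_def set_Cons_def)

lemma append_mem_multi_indices:
  "length i = length ds \<Longrightarrow>
    i @ j \<in> multi_indices (ds @ es) \<longleftrightarrow> i \<in> multi_indices ds \<and> j \<in> multi_indices es"
  by (auto simp: mem_multi_indices_append length_multi_indices)

text \<open>
  The sizes of the two index blocks are left free.  All tensors of order \<open>2N\<close> together are
  closed under product and conjugate transpose.  A product with different inner dimensions sums over
  their common indices, by the extension by zero, so the product of all pairs is associative.
\<close>

definition even_tensors :: "nat \<Rightarrow> tensor set" where
  "even_tensors N = {A. length (dims A) = 2 * N}"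

definition row_dims :: "nat \<Rightarrow> tensor \<Rightarrow> nat list" where
  "row_dims N A = take N (dims A)"

definition col_dims :: "nat \<Rightarrow> tensor \<Rightarrow> nat list" where
  "col_dims N A = drop N (dims A)"

lemma dims_eq: "dims A = row_dims N A @ col_dims N A"
  by (simp add: row_dims_def col_dims_def)

lemma length_row_dims [simp]: "A \<in> even_tensors N \<Longrightarrow> length (row_dims N A) = N"
  and length_col_dims [simp]: "A \<in> even_tensors N \<Longrightarrow> length (col_dims N A) = N"
  by (simp_all add: even_tensors_def row_dims_def col_dims_def)

lemma einstein_prod_closed [simp]:
    "A \<in> even_tensors N \<Longrightarrow> B \<in> even_tensors N \<Longrightarrow> A \<star>\<^bsub>N\<^esub> B \<in> even_tensors N"
  and row_dims_einstein_prod [simp]: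
    "A \<in> even_tensors N \<Longrightarrow> row_dims N (A \<star>\<^bsub>N\<^esub> B) = row_dims N A"
  and col_dims_einstein_prod [simp]:
    "A \<in> even_tensors N \<Longrightarrow> col_dims N (A \<star>\<^bsub>N\<^esub> B) = col_dims N B"
  by (simp_all add: even_tensors_def row_dims_def col_dims_def einstein_prod_def)

lemma conj_transpose_closed [simp]:
    "A \<in> even_tensors N \<Longrightarrow> conj_transpose N A \<in> even_tensors N"
  and row_dims_conj_transpose [simp]:
    "A \<in> even_tensors N \<Longrightarrow> row_dims N (conj_transpose N A) = col_dims N A"
  and col_dims_conj_transpose [simp]:
    "A \<in> even_tensors N \<Longrightarrow> col_dims N (conj_transpose N A) = row_dims N A"
  by (simp_all add: even_tensors_def row_dims_def col_dims_def conj_transpose_def)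

lemma entry_outside_block:
  assumes "A \<in> even_tensors N" "length i = N"
    and "i \<notin> multi_indices (row_dims N A) \<or> j \<notin> multi_indices (col_dims N A)"
  shows "entry A (i @ j) = 0"
proof -
  have "i @ j \<notin> multi_indices (row_dims N A @ col_dims N A)"
    using assms by (auto simp: append_mem_multi_indices)
  then show ?thesis
    using entry_outside by (metis dims_eq)
qed

lemma even_tensor_eqI:
  assumes "A \<in> even_tensors N" "B \<in> even_tensors N"
    and "row_dims N A = row_dims N B" "col_dims N A = col_dims N B"
    and "\<And>i j. i \<in> multi_indices (row_dims N A) \<Longrightarrow> j \<in> multi_indices (col_dims N A) \<Longrightarrow>
      length i = N \<Longrightarrow> length j = N \<Longrightarrow> entry A (i @ j) = entry B (i @ j)"
  shows "A = B"
proof (rule tensor_eqI)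
  show "dims A = dims B" using assms(3,4) by (metis dims_eq)
  fix l assume "l \<in> multi_indices (dims A)"
  then obtain i j where "i \<in> multi_indices (row_dims N A)" "j \<in> multi_indices (col_dims N A)" "l = i @ j"
    unfolding dims_eq [of A N] mem_multi_indices_append by blast
  then show "entry A l = entry B l"
    using assms by (metis length_col_dims length_multi_indices length_row_dims)
qed

lemma entry_einstein_prod:
  assumes A: "A \<in> even_tensors N" and B: "B \<in> even_tensors N" and i: "length i = N"
  shows "entry (A \<star>\<^bsub>N\<^esub> B) (i @ j) =
    (\<Sum>k\<in>multi_indices (row_dims N B). entry A (i @ k) * entry B (k @ j))"
proof (cases "i \<in> multi_indices (row_dims N A) \<and> j \<in> multi_indices (col_dims N B)")
  case True
  then have "i @ j \<in> multi_indices (row_dims N A @ col_dims N B)"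
    by (auto simp: mem_multi_indices_append)
  then show ?thesis
    using i by (simp add: einstein_prod_def entry_mk_tensor flip: row_dims_def col_dims_def)
next
  case False
  then have "entry (A \<star>\<^bsub>N\<^esub> B) (i @ j) = 0"
    using A B i by (intro entry_outside_block [of _ N]) simp_all
  moreover have "(\<Sum>k\<in>multi_indices (row_dims N B). entry A (i @ k) * entry B (k @ j)) = 0"
    using False A B i
    by (intro sum.neutral) (auto intro: entry_outside_block simp: length_multi_indices)
  ultimately show ?thesis by simp
qed

text \<open>
  The definition sums over the row indices of the right factor.  By the extension by zero, only
  indices that also belong to the columns of the left factor contribute, so
  the column indices of the left factor serve as well.  The conjugate transpose of a product needs
  this form because it exchanges the factors.
\<close>

lemma entry_einstein_prod_col:
  assumes A: "A \<in> even_tensors N" and B: "B \<in> even_tensors N" and i: "length i = N"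
  shows "entry (A \<star>\<^bsub>N\<^esub> B) (i @ j) =
    (\<Sum>k\<in>multi_indices (col_dims N A). entry A (i @ k) * entry B (k @ j))"
proof -
  let ?f = "\<lambda>k. entry A (i @ k) * entry B (k @ j)"
  let ?R = "multi_indices (row_dims N B)" and ?C = "multi_indices (col_dims N A)"
  have "sum ?f ?R = sum ?f (?R \<inter> ?C)"
    using A i by (intro sum.mono_neutral_right) (auto simp: entry_outside_block [where N = N])
  moreover have "sum ?f ?C = sum ?f (?R \<inter> ?C)"
    using A B by (intro sum.mono_neutral_right)
      (auto intro: entry_outside_block [where N = N] simp: length_multi_indices)
  ultimately show ?thesis using entry_einstein_prod [OF assms] by simp
qed

lemma entry_conj_transpose:
  assumes A: "A \<in> even_tensors N" and "length i = N" "length j = N"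
  shows "entry (conj_transpose N A) (j @ i) = cnj (entry A (i @ j))"
proof (cases "i \<in> multi_indices (row_dims N A) \<and> j \<in> multi_indices (col_dims N A)")
  case True
  then have "j @ i \<in> multi_indices (col_dims N A @ row_dims N A)"
    by (auto simp: mem_multi_indices_append)
  then show ?thesis
    using assms by (simp add: conj_transpose_def entry_mk_tensor flip: row_dims_def col_dims_def)
next
  case False
  then show ?thesis
    using assms by (auto simp: entry_outside_block [where N = N])
qed

lemma einstein_prod_assoc:
  assumes A: "A \<in> even_tensors N" and B: "B \<in> even_tensors N" and C: "C \<in> even_tensors N"
  shows "A \<star>\<^bsub>N\<^esub> B \<star>\<^bsub>N\<^esub> C = A \<star>\<^bsub>N\<^esub> (B \<star>\<^bsub>N\<^esub> C)"
proof (rule even_tensor_eqI)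
  fix i j :: "nat list" assume i: "length i = N" and j: "length j = N"
  have "entry (A \<star>\<^bsub>N\<^esub> B \<star>\<^bsub>N\<^esub> C) (i @ j) =
      (\<Sum>k\<in>multi_indices (row_dims N C). \<Sum>m\<in>multi_indices (row_dims N B).
        entry A (i @ m) * (entry B (m @ k) * entry C (k @ j)))"
    using A B C i by (simp add: entry_einstein_prod sum_distrib_right mult.assoc)
  also have "\<dots> = (\<Sum>m\<in>multi_indices (row_dims N B). \<Sum>k\<in>multi_indices (row_dims N C).
        entry A (i @ m) * (entry B (m @ k) * entry C (k @ j)))"
    by (rule sum.swap)
  also have "\<dots> = entry (A \<star>\<^bsub>N\<^esub> (B \<star>\<^bsub>N\<^esub> C)) (i @ j)"
    using A B C i by (simp add: entry_einstein_prod sum_distrib_left length_multi_indices)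
  finally show "entry (A \<star>\<^bsub>N\<^esub> B \<star>\<^bsub>N\<^esub> C) (i @ j) = entry (A \<star>\<^bsub>N\<^esub> (B \<star>\<^bsub>N\<^esub> C)) (i @ j)" .
qed (use A B C in simp_all)

lemma conj_transpose_einstein_prod:
  assumes A: "A \<in> even_tensors N" and B: "B \<in> even_tensors N"
  shows "conj_transpose N (A \<star>\<^bsub>N\<^esub> B) = conj_transpose N B \<star>\<^bsub>N\<^esub> conj_transpose N A"
proof (rule even_tensor_eqI)
  fix i j :: "nat list" assume i: "length i = N" and j: "length j = N"
  show "entry (conj_transpose N (A \<star>\<^bsub>N\<^esub> B)) (i @ j) =
      entry (conj_transpose N B \<star>\<^bsub>N\<^esub> conj_transpose N A) (i @ j)"
    using A B i j entry_einstein_prod_col [OF A B j, of i]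
    by (simp add: entry_conj_transpose entry_einstein_prod [of "conj_transpose N B"]
        length_multi_indices mult.commute)
qed (use A B in simp_all)

lemma conj_transpose_conj_transpose:
  "A \<in> even_tensors N \<Longrightarrow> conj_transpose N (conj_transpose N A) = A"
  by (rule even_tensor_eqI [of _ N]) (simp_all add: entry_conj_transpose)

text \<open>
  On the diagonal entry \<open>(j, j)\<close> the two equations add up to
  \<open>\<Sum>\<^sub>k |x\<^sub>k\<^sub>j - y\<^sub>k\<^sub>j|\<^sup>2 = 0\<close>.
\<close>

lemma conj_transpose_proper:
  assumes X: "X \<in> even_tensors N" and Y: "Y \<in> even_tensors N"
    and row: "row_dims N X = row_dims N Y"
    and xx: "conj_transpose N X \<star>\<^bsub>N\<^esub> X = conj_transpose N X \<star>\<^bsub>N\<^esub> Y"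
    and yy: "conj_transpose N Y \<star>\<^bsub>N\<^esub> Y = conj_transpose N Y \<star>\<^bsub>N\<^esub> X"
  shows "X = Y"
proof (rule even_tensor_eqI)
  show "col_dims N X = col_dims N Y"
    using arg_cong [OF xx, of "col_dims N"] X Y by simp
  fix i j :: "nat list" assume i: "i \<in> multi_indices (row_dims N X)" and j: "length j = N"
  let ?I = "multi_indices (row_dims N X)"
  let ?x = "\<lambda>k. entry X (k @ j)" and ?y = "\<lambda>k. entry Y (k @ j)"
  have "(\<Sum>k\<in>?I. cnj (?x k) * ?x k) = (\<Sum>k\<in>?I. cnj (?x k) * ?y k)"
    using arg_cong [OF xx, of "\<lambda>T. entry T (j @ j)"] X Y row j
    by (simp add: entry_einstein_prod entry_conj_transpose length_multi_indices)
  moreover have "(\<Sum>k\<in>?I. cnj (?y k) * ?y k) = (\<Sum>k\<in>?I. cnj (?y k) * ?x k)"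
    using arg_cong [OF yy, of "\<lambda>T. entry T (j @ j)"] X Y row j
    by (simp add: entry_einstein_prod entry_conj_transpose length_multi_indices)
  ultimately have "(\<Sum>k\<in>?I. (?x k - ?y k) * cnj (?x k - ?y k)) = 0"
    by (simp add: algebra_simps sum.distrib sum_subtractf)
  then have "complex_of_real (\<Sum>k\<in>?I. (cmod (?x k - ?y k))\<^sup>2) = 0"
    by (simp only: complex_norm_square of_real_sum)
  then have "(\<Sum>k\<in>?I. (cmod (?x k - ?y k))\<^sup>2) = 0"
    by (simp only: of_real_eq_0_iff)
  then show "?x i = ?y i"
    using i by (simp add: sum_nonneg_eq_0_iff)
qed (use X Y row in simp_all)

section \<open>Inner inverses of tensors\<close>

lemma sum_fun_apply: "(\<Sum>x\<in>A. f x) y = (\<Sum>x\<in>A. f x y)"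
  by (induction A rule: infinite_finite_induct) simp_all

text \<open>
  A right inverse \<open>h\<close> of the linear map \<open>f\<close> given by \<open>a\<close> on the range of \<open>f\<close> satisfies
  \<open>f \<circ> h \<circ> f = f\<close>; the matrix of \<open>h\<close> is the required inner inverse.
\<close>

lemma matrix_inner_inverse:
  fixes a :: "'i \<Rightarrow> 'k \<Rightarrow> complex"
  assumes U: "finite U" and V: "finite V"
  shows "\<exists>g. \<forall>i\<in>U. \<forall>k\<in>V. (\<Sum>q\<in>U. (\<Sum>p\<in>V. a i p * g p q) * a q k) = a i k"
proof -
  interpret domain: vector_space "\<lambda>(c::complex) (x::'k \<Rightarrow> complex) k. c * x k"
    by unfold_locales (simp_all add: fun_eq_iff algebra_simps)
  interpret codomain: vector_space "\<lambda>(c::complex) (y::'i \<Rightarrow> complex) i. c * y i"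
    by unfold_locales (simp_all add: fun_eq_iff algebra_simps)
  interpret forward: vector_space_pair "\<lambda>(c::complex) (x::'k \<Rightarrow> complex) k. c * x k"
    "\<lambda>(c::complex) (y::'i \<Rightarrow> complex) i. c * y i" ..
  \<comment> \<open>The value \<open>0\<close> outside \<open>U\<close> makes each \<open>f x\<close> a finite combination of unit vectors.\<close>
  define f where "f x = (\<lambda>i. if i \<in> U then \<Sum>p\<in>V. a i p * x p else 0)" for x
  have "Vector_Spaces.linear (\<lambda>c x k. c * x k) (\<lambda>c y i. c * y i) f"
    by unfold_locales
      (simp_all add: f_def fun_eq_iff algebra_simps sum.distrib sum_distrib_left)
  then obtain h where h: "Vector_Spaces.linear (\<lambda>c y i. c * y i) (\<lambda>c x k. c * x k) h"
    and fh: "\<And>x. f (h (f x)) = f x"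
    using forward.linear_exists_right_inverse_on [of f UNIV] by auto
  interpret h: Vector_Spaces.linear "\<lambda>c y i. c * y i" "\<lambda>c x k. c * x k" h by (rule h)
  define g where "g p q = h (\<lambda>i. if i = q then 1 else 0) p" for p q
  show ?thesis
  proof (intro exI ballI)
    fix i k assume i: "i \<in> U" and k: "k \<in> V"
    define e where "e = (\<lambda>p. if p = k then 1 else 0 :: complex)"
    have fe: "f e = (\<lambda>i. if i \<in> U then a i k else 0)"
      using k V by (simp add: f_def e_def if_distrib [of "\<lambda>z. _ * z"] cong: if_cong)
    also have "\<dots> = (\<Sum>q\<in>U. (\<lambda>i. a q k * (if i = q then 1 else 0)))"
      using U by (auto simp: fun_eq_iff if_distrib [of "\<lambda>z. _ * z"] sum_fun_apply cong: if_cong)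
    finally have "h (f e) = (\<Sum>q\<in>U. (\<lambda>p. a q k * g p q))"
      by (simp only: h.sum h.scale g_def)
    then have "h (f e) p = (\<Sum>q\<in>U. a q k * g p q)" for p
      by (simp add: sum_fun_apply)
    then have "f (h (f e)) i = (\<Sum>p\<in>V. \<Sum>q\<in>U. a i p * (a q k * g p q))"
      using i by (simp add: f_def sum_distrib_left)
    also have "\<dots> = (\<Sum>q\<in>U. (\<Sum>p\<in>V. a i p * g p q) * a q k)"
      by (subst sum.swap) (simp add: sum_distrib_left sum_distrib_right mult_ac)
    finally show "(\<Sum>q\<in>U. (\<Sum>p\<in>V. a i p * g p q) * a q k) = a i k"
      using i fh [of e] fe by simp
  qed
qed

lemma tensor_inner_inverse:
  assumes A: "A \<in> even_tensors N"
  shows "\<exists>G\<in>even_tensors N. A \<star>\<^bsub>N\<^esub> G \<star>\<^bsub>N\<^esub> A = A"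
proof -
  let ?U = "multi_indices (row_dims N A)" and ?V = "multi_indices (col_dims N A)"
  obtain g where g: "\<forall>i\<in>?U. \<forall>k\<in>?V.
      (\<Sum>q\<in>?U. (\<Sum>p\<in>?V. entry A (i @ p) * g p q) * entry A (q @ k)) = entry A (i @ k)"
    using matrix_inner_inverse [of ?U ?V "\<lambda>i k. entry A (i @ k)"] by auto
  define G where "G = mk_tensor (col_dims N A @ row_dims N A) (\<lambda>l. g (take N l) (drop N l))"
  have G: "G \<in> even_tensors N" and row: "row_dims N G = col_dims N A"
    using A by (simp_all add: G_def even_tensors_def row_dims_def col_dims_def)
  have entry_G: "entry G (p @ q) = g p q" if "p \<in> ?V" "q \<in> ?U" for p q
    using that A length_multi_indices [OF that(1)]
    by (auto simp: G_def entry_mk_tensor mem_multi_indices_append)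
  have "A \<star>\<^bsub>N\<^esub> G \<star>\<^bsub>N\<^esub> A = A"
  proof (rule even_tensor_eqI)
    fix i k
    assume "i \<in> multi_indices (row_dims N (A \<star>\<^bsub>N\<^esub> G \<star>\<^bsub>N\<^esub> A))"
      and "k \<in> multi_indices (col_dims N (A \<star>\<^bsub>N\<^esub> G \<star>\<^bsub>N\<^esub> A))" and "length i = N"
    then show "entry (A \<star>\<^bsub>N\<^esub> G \<star>\<^bsub>N\<^esub> A) (i @ k) = entry A (i @ k)"
      using A G g by (simp add: entry_einstein_prod row entry_G)
  qed (use A G in simp_all)
  with G show ?thesis by blast
qed

section \<open>The reverse order law for tensors\<close>

interpretation tensor: regular_star_semigroup "even_tensors N" "\<lambda>A B. A \<star>\<^bsub>N\<^esub> B"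
  "conj_transpose N" "row_dims N" for N
  by unfold_locales
    (simp_all add: conj_transpose_einstein_prod conj_transpose_conj_transpose
      conj_transpose_proper tensor_inner_inverse, rule einstein_prod_assoc)

text \<open>
  The Penrose equations determine the size of \<open>X\<close>: the row dimensions by \<open>penrose_row\<close>, the
  column dimensions because \<open>AX\<close>, being Hermitian, has equal row and column dimensions.
\<close>

lemma is_mp_inverse_iff_penrose:
  assumes A: "A \<in> even_tensors N"
  shows "is_mp_inverse N A X \<longleftrightarrow> X \<in> even_tensors N \<and> tensor.penrose N A X"
proof
  assume "is_mp_inverse N A X"
  then show "X \<in> even_tensors N \<and> tensor.penrose N A X"
    using A by (simp add: is_mp_inverse_def tensor.penrose_def even_tensors_def)
next
  assume X: "X \<in> even_tensors N \<and> tensor.penrose N A X"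
  have row: "row_dims N X = col_dims N A"
    using tensor.penrose_row [of A N X] A X by simp
  have "col_dims N X = col_dims N (A \<star>\<^bsub>N\<^esub> X)" using A by simp
  also have "\<dots> = col_dims N (conj_transpose N (A \<star>\<^bsub>N\<^esub> X))"
    using X by (simp add: tensor.penrose_def)
  also have "\<dots> = row_dims N A" using A X by simp
  finally have "dims X = drop N (dims A) @ take N (dims A)"
    using row by (metis dims_eq row_dims_def col_dims_def)
  then show "is_mp_inverse N A X"
    using X by (simp add: is_mp_inverse_def tensor.penrose_def)
qed

text \<open>
  The description operator in \<open>mp_inverse\<close> denotes the Moore-Penrose inverse only because it exists
  and is unique.
\<close>

lemma mp_inverse_eq_iff:
  assumes A: "A \<in> even_tensors N" and X: "X \<in> even_tensors N"
  shows "mp_inverse N A = X \<longleftrightarrow> tensor.penrose N A X"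
proof -
  have "\<exists>!X. is_mp_inverse N A X"
    using tensor.penrose_exists [OF A] tensor.penrose_unique [OF A]
    by (auto simp: is_mp_inverse_iff_penrose [OF A])
  then show ?thesis
    unfolding mp_inverse_def using is_mp_inverse_iff_penrose [OF A] X by (metis theI')
qed

lemma mp_inverse_closed:
  assumes "A \<in> even_tensors N"
  shows "mp_inverse N A \<in> even_tensors N"
  using mp_inverse_eq_iff [OF assms] tensor.penrose_exists [OF assms] by auto

theorem theorem3p25:
  fixes A B :: tensor and I J :: "nat list" and N :: nat
  assumes "length I = N" and "length J = N"
    and "dims A = I @ J" and "dims B = J @ I"
  shows "mp_inverse N (A \<star>\<^bsub>N\<^esub> B) = mp_inverse N B \<star>\<^bsub>N\<^esub> mp_inverse N A \<longleftrightarrow>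
    mp_inverse N A \<star>\<^bsub>N\<^esub> A \<star>\<^bsub>N\<^esub> B \<star>\<^bsub>N\<^esub> conj_transpose N B \<star>\<^bsub>N\<^esub> conj_transpose N A
      = B \<star>\<^bsub>N\<^esub> conj_transpose N B \<star>\<^bsub>N\<^esub> conj_transpose N A \<and>
    B \<star>\<^bsub>N\<^esub> mp_inverse N B \<star>\<^bsub>N\<^esub> conj_transpose N A \<star>\<^bsub>N\<^esub> A \<star>\<^bsub>N\<^esub> B
      = conj_transpose N A \<star>\<^bsub>N\<^esub> A \<star>\<^bsub>N\<^esub> B"
proof -
  have A: "A \<in> even_tensors N" and B: "B \<in> even_tensors N"
    using assms by (simp_all add: even_tensors_def)
  have "row_dims N B = row_dims N (conj_transpose N A)" "row_dims N A = row_dims N (conj_transpose N B)"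
    using assms A B by (simp_all, simp_all add: row_dims_def col_dims_def)
  moreover have "tensor.penrose N A (mp_inverse N A)" "tensor.penrose N B (mp_inverse N B)"
    using A B mp_inverse_closed mp_inverse_eq_iff by blast+
  ultimately show ?thesis
    using A B by (simp add: mp_inverse_eq_iff mp_inverse_closed tensor.reverse_order_law)
qed

end
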